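(* For $k\ge 4$, the fan $F_k$ has $r$-critical pebbling number $c_r(F_k)=k$.
   Context: The fan $F_k$ is the path $P_k$ on $k$ vertices together with an additional vertex $x$ adjacent to every vertex of the path. A pebbling distribution assigns to each vertex a non-negative integer number of pebbles. A pebbling step $[a,b]$, for adjacent $a,b$, removes two pebbles from $a$ and adds one to $b$. A rooted distribution with root $r$ is $r$-solvable if some sequence of pebbling steps ends with at least one pebble on $r$; it is $r$-critical if it is $r$-solvable but removing any single pebble makes it not $r$-solvable. $c_r(G)$ is the largest number of pebbles in an $r$-critical rooted distribution on $G$, over all roots $r$. *)

theory Defs
  imports "HOL-Library.Multiset" "Graph_Theory.Pair_Digraph"
begin

text \<open>
  An undirected simple graph is a symmetric, loop-free digraph without parallel arcs
  (locale \<open>pair_graph\<close>): each edge is represented by its two arcs.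
\<close>

definition path_graph :: "nat \<Rightarrow> nat pair_pre_digraph" where
  "path_graph k = \<lparr> pverts = {..<k},
     parcs = {(i, j). i < k \<and> j < k \<and> (j = Suc i \<or> i = Suc j)} \<rparr>"

text \<open>The additional vertex is \<open>None\<close>; path vertex \<open>i\<close> becomes \<open>Some i\<close>.\<close>

definition fan :: "nat \<Rightarrow> nat option pair_pre_digraph" where
  "fan k = \<lparr> pverts = insert None (Some ` pverts (path_graph k)),
     parcs = map_prod Some Some ` parcs (path_graph k)
       \<union> {None} \<times> Some ` pverts (path_graph k)
       \<union> Some ` pverts (path_graph k) \<times> {None} \<rparr>"

lemma pair_graph_fan: "pair_graph (fan k)"
proof
  show "finite (pverts (fan k))" by (simp add: fan_def path_graph_def)
  show "symmetric (with_proj (fan k))"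
    by (auto simp: symmetric_def fan_def path_graph_def sym_def image_iff)
  show "fst e \<noteq> snd e" if "e \<in> parcs (fan k)" for e
    using that by (auto simp: fan_def path_graph_def)
  show "fst e \<in> pverts (fan k)" "snd e \<in> pverts (fan k)" if "e \<in> parcs (fan k)" for e
    using that by (auto simp: fan_def path_graph_def)
  then show "finite (parcs (fan k))"
    by (intro finite_subset[OF _ finite_cartesian_product[OF \<open>finite (pverts (fan k))\<close>
          \<open>finite (pverts (fan k))\<close>]]) (auto simp: mem_Times_iff)
qed

text \<open>
  A pebbling distribution is a multiset \<open>D\<close> of vertices: vertex \<open>v\<close> carries \<open>count D v\<close>
  pebbles, and \<open>size D\<close> is the total number of pebbles.
\<close>

definition pebbling_distribution :: "'a pair_pre_digraph \<Rightarrow> 'a multiset \<Rightarrow> bool" where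
  "pebbling_distribution G D \<longleftrightarrow> set_mset D \<subseteq> pverts G"

inductive pebbling_step :: "'a pair_pre_digraph \<Rightarrow> 'a multiset \<Rightarrow> 'a multiset \<Rightarrow> bool"
  for G :: "'a pair_pre_digraph" where
  "(a, b) \<in> parcs G \<Longrightarrow> 2 \<le> count D a \<Longrightarrow> pebbling_step G D (D - {#a, a#} + {#b#})"

definition solvable :: "'a pair_pre_digraph \<Rightarrow> 'a \<Rightarrow> 'a multiset \<Rightarrow> bool" where
  "solvable G r D \<longleftrightarrow> (\<exists>D'. (pebbling_step G)\<^sup>*\<^sup>* D D' \<and> 1 \<le> count D' r)"

definition critical :: "'a pair_pre_digraph \<Rightarrow> 'a \<Rightarrow> 'a multiset \<Rightarrow> bool" where
  "critical G r D \<longleftrightarrow> solvable G r D \<and> (\<forall>v \<in># D. \<not> solvable G r (D - {#v#}))"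

definition critical_pebbling_number :: "'a pair_pre_digraph \<Rightarrow> nat" where
  "critical_pebbling_number G =
     (GREATEST n. \<exists>r D. r \<in> pverts G \<and> pebbling_distribution G D \<and> critical G r D \<and> size D = n)"

end

theory Submission
  imports Defs
begin

text \<open>
  A critical distribution has no proper solvable sub-distribution. Two pebbles on a path vertex
  put one pebble on the hub, and two pebbles on the hub solve any root on the path. So for such a
  root, a critical distribution
  with more than four pebbles has none on the hub and one vertex with two or three pebbles,
  all others having at most one. Having more than \<open>k\<close> pebbles would then force every non-root
  path vertex to be occupied, and carrying the pair along the path to the root uses at most \<open>k\<close>
  pebbles. That transport, starting at the far end of the path, is itself a critical distribution
  with \<open>k\<close> pebbles.
\<close>

section \<open>Pebbling on arbitrary graphs\<close>

lemma pair_subseteq_mset_iff: "{#a, a#} \<subseteq># D \<longleftrightarrow> 2 \<le> count D a"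
  by (simp add: count_le_replicate_mset_subset_eq numeral_2_eq_2)

lemma solvable_root: "r \<in># D \<Longrightarrow> solvable G r D"
  unfolding solvable_def by (intro exI[of _ D]) (simp add: Suc_le_eq)

lemma solvable_step:
  assumes "(a, b) \<in> parcs G" "solvable G r (add_mset b D)"
  shows "solvable G r (add_mset a (add_mset a D))"
proof -
  have "pebbling_step G (add_mset a (add_mset a D)) (add_mset b D)"
    using pebbling_step.intros[OF assms(1), of "add_mset a (add_mset a D)"] by simp
  then show ?thesis
    using assms(2) unfolding solvable_def by (meson converse_rtranclp_into_rtranclp)
qed

lemma pebbling_step_add:
  assumes "pebbling_step G D D'"
  shows "pebbling_step G (D + E) (D' + E)"
  using assms
proof cases
  case (1 a b)
  obtain D0 where D0: "D = {#a, a#} + D0"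
    using 1(3) by (metis pair_subseteq_mset_iff subset_mset.add_diff_inverse)
  have "pebbling_step G (D + E) (D + E - {#a, a#} + {#b#})"
    using 1(2,3) by (intro pebbling_step.intros) simp_all
  also have "D + E - {#a, a#} + {#b#} = D' + E"
    unfolding 1(1) D0 by simp
  finally show ?thesis .
qed

text \<open>The surplus pebbles \<open>E - D\<close> ride along untouched through every step that
  solves \<open>D\<close>.\<close>

lemma solvable_mono:
  assumes "solvable G r D" "D \<subseteq># E"
  shows "solvable G r E"
proof -
  obtain D' where D': "(pebbling_step G)\<^sup>*\<^sup>* D D'" "1 \<le> count D' r"
    using assms(1) unfolding solvable_def by blast
  from D'(1) have "(pebbling_step G)\<^sup>*\<^sup>* (D + (E - D)) (D' + (E - D))"
    by induction (auto intro: pebbling_step_add rtranclp.rtrancl_into_rtrancl)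
  moreover have "1 \<le> count (D' + (E - D)) r"
    using D'(2) unfolding count_union by linarith
  ultimately show ?thesis
    using assms(2) unfolding solvable_def by (metis subset_mset.add_diff_inverse)
qed

text \<open>A proper sub-distribution misses a pebble on some \<open>v\<close>, so it lies inside
  \<open>D - {#v#}\<close>; monotonicity then reduces the claim to single removals.\<close>

lemma critical_minimal:
  assumes "critical G r D" "S \<subseteq># D" "solvable G r S"
  shows "S = D"
proof (rule ccontr)
  assume "S \<noteq> D"
  then obtain v where less: "count S v < count D v"
    using assms(2) by (metis le_neq_implies_less mset_subset_eq_count multiset_eqI)
  then have v: "v \<in># D"
    by (metis count_greater_zero_iff gr_zeroI not_less_zero)
  have "S \<subseteq># D - {#v#}"
    using less assms(2) by (auto simp: subseteq_mset_def)
  then show False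
    using assms v unfolding critical_def by (metis solvable_mono)
qed

text \<open>The pair on \<open>v\<close> becomes one pebble on the next vertex, which forms a new
  pair with the pebble waiting there; this repeats until \<open>r\<close> is reached.\<close>

lemma solvable_walk:
  assumes "successively (\<lambda>a b. (a, b) \<in> parcs G) (v # ws @ [r])"
  shows "solvable G r (add_mset v (mset (v # ws)))"
  using assms
proof (induction ws arbitrary: v)
  case Nil
  then show ?case
    using solvable_step[of v r G r "{#}"] solvable_root[of r "{#r#}"] by simp
next
  case (Cons w ws)
  then show ?case
    using solvable_step[of v w G r "add_mset w (mset ws)"] by simp
qed

section \<open>Adjacency, walks and small solvable distributions in the fan\<close>

lemma pverts_fan: "pverts (fan k) = insert None (Some ` {..<k})"
  by (simp add: fan_def path_graph_def)

lemma parcs_fan: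
  "(Some i, Some j) \<in> parcs (fan k) \<longleftrightarrow> i < k \<and> j < k \<and> (j = Suc i \<or> i = Suc j)"
  "(None, Some j) \<in> parcs (fan k) \<longleftrightarrow> j < k"
  "(Some i, None) \<in> parcs (fan k) \<longleftrightarrow> i < k"
  "(None, None) \<notin> parcs (fan k)"
  by (auto simp: fan_def path_graph_def image_iff)

lemma size_fan_distribution:
  assumes "pebbling_distribution (fan k) D"
  shows "size D = count D None + (\<Sum>i<k. count D (Some i))"
proof -
  have "size D = sum (count D) (insert None (Some ` {..<k}))"
    unfolding size_multiset_overloaded_eq using assms
    by (intro sum.mono_neutral_left)
       (auto simp: pebbling_distribution_def pverts_fan not_in_iff)
  then show ?thesis
    by (subst (asm) sum.insert) (auto simp: sum.reindex)
qed

text \<open>The walk runs monotonically along the path and avoids the hub. Distinctness later bounds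
  its length by \<open>k\<close>.\<close>

lemma fan_path_walk:
  assumes "v < k" "s < k" "v \<noteq> s"
  obtains ws where "successively (\<lambda>a b. (a, b) \<in> parcs (fan k)) (map Some (v # ws @ [s]))"
    "distinct (v # ws @ [s])" "set ws \<subseteq> {..<k}"
proof (cases "v < s")
  case True
  then have eq: "v # [Suc v..<s] @ [s] = [v..<Suc s]"
    by (simp add: upt_conv_Cons)
  show ?thesis
  proof (rule that[of "[Suc v..<s]"])
    show "successively (\<lambda>a b. (a, b) \<in> parcs (fan k)) (map Some (v # [Suc v..<s] @ [s]))"
      unfolding eq using assms by (auto simp: successively_conv_nth parcs_fan simp del: upt_Suc)
  qed (use assms in auto)
next
  case False
  with assms have "s < v" by simp
  then have eq: "v # rev [Suc s..<v] @ [s] = rev [s..<Suc v]"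
    by (simp add: upt_conv_Cons)
  show ?thesis
  proof (rule that[of "rev [Suc s..<v]"])
    show "successively (\<lambda>a b. (a, b) \<in> parcs (fan k)) (map Some (v # rev [Suc s..<v] @ [s]))"
      unfolding eq rev_map[symmetric] successively_rev
      using assms by (auto simp: successively_conv_nth parcs_fan simp del: upt_Suc)
  qed (use assms in auto)
qed

lemma sum_le_card_plus_2:
  fixes f :: "'a \<Rightarrow> nat"
  assumes "finite A" "v \<in> A" "f v \<le> 3" "\<And>i. i \<in> A \<Longrightarrow> i \<noteq> v \<Longrightarrow> f i \<le> 1"
  shows "sum f A \<le> card A + 2"
proof -
  have "sum f A \<le> (\<Sum>i\<in>A. 1 + (if i = v then 2 else 0))"
    using assms by (intro sum_mono) auto
  also have "\<dots> = card A + 2"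
    using assms by (subst sum.distrib) simp
  finally show ?thesis .
qed

lemma solvable_fan_hub:
  "s < k \<Longrightarrow> solvable (fan k) (Some s) {#None, None#}"
  using solvable_walk[of "fan k" None "[]" "Some s"] by (simp add: parcs_fan)

lemma solvable_fan_hub_pair:
  assumes "s < k" "a < k"
  shows "solvable (fan k) (Some s) {#None, Some a, Some a#}"
  using solvable_step[of "Some a" None "fan k" "Some s" "{#None#}"] solvable_fan_hub[of s k] assms
  by (simp add: parcs_fan add_mset_commute)

text \<open>Each pair sends one pebble to the hub. The case \<open>a = b\<close> covers four pebbles
  on one vertex.\<close>

lemma solvable_fan_two_pairs:
  assumes "s < k" "a < k" "b < k"
  shows "solvable (fan k) (Some s) {#Some a, Some a, Some b, Some b#}"
  using solvable_step[of "Some a" None "fan k" "Some s" "{#Some b, Some b#}"]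
    solvable_fan_hub_pair[of s k b] assms
  by (simp add: parcs_fan)

section \<open>Upper bound on critical distributions\<close>

lemma critical_fan_size_le:
  assumes k: "k \<ge> 4" and r: "r \<in> pverts (fan k)"
    and D: "pebbling_distribution (fan k) D" and crit: "critical (fan k) r D"
  shows "size D \<le> k"
proof (rule ccontr)
  assume "\<not> size D \<le> k"
  then have big: "k < size D" by simp
  \<comment> \<open>By minimality a solvable sub-distribution is all of \<open>D\<close>, which has
    more than \<open>k\<close> pebbles. Since \<open>k \<ge> 4\<close>, this excludes every solvable
    configuration of at most four pebbles.\<close>
  have small: "\<not> S \<subseteq># D" if "solvable (fan k) r S" "size S \<le> k" for S
    using critical_minimal[OF crit _ that(1)] that(2) big by auto
  have r0: "count D r = 0"
    using small[of "{#r#}"] solvable_root[of r "{#r#}"] k by (simp add: not_in_iff)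
  note size = size_fan_distribution[OF D]
  have sum_le: "(\<Sum>i\<in>A. count D (Some i)) \<le> card A"
    if "\<And>i. i \<in> A \<Longrightarrow> count D (Some i) \<le> 1" for A
    using sum_bounded_above[of A "\<lambda>i. count D (Some i)" 1] that by simp
  show False
  proof (cases r)
    case None
    have "count D (Some a) \<le> 1" if "a < k" for a
      using small[of "{#Some a, Some a#}"] solvable_walk[of "fan k" "Some a" "[]" r] that k None
      by (simp add: parcs_fan pair_subseteq_mset_iff)
    then show False
      using sum_le[of "{..<k}"] size r0 None big by auto
  next
    case (Some s)
    with r have s: "s < k" by (auto simp: pverts_fan)
    have x1: "count D None \<le> 1"
      using small[OF solvable_fan_hub[OF s, folded Some]] k
      by (simp add: pair_subseteq_mset_iff)
    have sum_s: "(\<Sum>i<k. count D (Some i)) = (\<Sum>i\<in>{..<k} - {s}. count D (Some i))"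
      using r0 s Some by (simp add: sum.remove)
    \<comment> \<open>Otherwise the path carries at most \<open>k - 1\<close> pebbles and the hub at
      most one, hence at most \<open>k\<close> in all.\<close>
    obtain v where v: "v < k" "v \<noteq> s" "count D (Some v) \<ge> 2"
    proof (rule ccontr)
      assume "\<not> thesis"
      then have "\<And>i. i \<in> {..<k} - {s} \<Longrightarrow> count D (Some i) \<le> 1"
        using that by force
      then have "(\<Sum>i<k. count D (Some i)) \<le> k - 1"
        using sum_le[of "{..<k} - {s}"] s sum_s by simp
      then show False
        using x1 size big k by simp
    qed
    have x0: "count D None = 0"
    proof (rule ccontr)
      assume "count D None \<noteq> 0"
      then have "{#None, Some v, Some v#} \<subseteq># D"
        using v by (auto simp: subseteq_mset_def)
      then show False
        using small[OF solvable_fan_hub_pair[OF s v(1), folded Some]] k by simp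
    qed
    have v3: "count D (Some v) \<le> 3"
    proof (rule ccontr)
      assume "\<not> ?thesis"
      then have "{#Some v, Some v, Some v, Some v#} \<subseteq># D"
        by (auto simp: subseteq_mset_def)
      then show False
        using small[OF solvable_fan_two_pairs[OF s v(1) v(1), folded Some]] k by simp
    qed
    have others: "count D (Some i) \<le> 1" if "i < k" "i \<noteq> v" for i
    proof (rule ccontr)
      assume "\<not> ?thesis"
      then have "{#Some v, Some v, Some i, Some i#} \<subseteq># D"
        using v that by (auto simp: subseteq_mset_def)
      then show False
        using small[OF solvable_fan_two_pairs[OF s v(1) that(1), folded Some]] k by simp
    qed
    \<comment> \<open>If \<open>u\<close> were empty as well as the root, the remaining
      \<open>k - 2\<close> path vertices would hold at most one pebble each, plus two extra on
      \<open>v\<close>: at most \<open>k\<close> in all.\<close>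
    have occupied: "count D (Some u) \<ge> 1" if u: "u < k" "u \<noteq> s" for u
    proof (rule ccontr)
      assume "\<not> ?thesis"
      then have u0: "count D (Some u) = 0" by linarith
      then have "u \<noteq> v" using v by auto
      have "(\<Sum>i<k. count D (Some i)) = (\<Sum>i\<in>{..<k} - {s, u}. count D (Some i))"
        using u0 r0 Some by (intro sum.mono_neutral_right) auto
      also have "\<dots> \<le> card ({..<k} - {s, u}) + 2"
        using v v3 others \<open>u \<noteq> v\<close> by (intro sum_le_card_plus_2[of _ v]) auto
      also have "card ({..<k} - {s, u}) = k - 2"
        using s u by (subst card_Diff_subset) auto
      finally show False
        using x0 size big k by simp
    qed
    obtain ws where ws: "successively (\<lambda>a b. (a, b) \<in> parcs (fan k)) (map Some (v # ws @ [s]))"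
      "distinct (v # ws @ [s])" "set ws \<subseteq> {..<k}"
      using fan_path_walk[OF v(1) s v(2)] .
    \<comment> \<open>The doubled pebble on \<open>v\<close> offsets the empty root, so
      \<open>S\<close> has as many pebbles as the walk has vertices.\<close>
    define S where "S = add_mset (Some v) (mset (map Some (v # ws)))"
    have "solvable (fan k) r S"
      using solvable_walk[of "fan k" "Some v" "map Some ws" r] ws(1) unfolding S_def Some by simp
    moreover have "size S \<le> k"
      using card_mono[of "{..<k}" "set (v # ws @ [s])"] distinct_card[OF ws(2)] ws(3) v(1) s
      unfolding S_def by simp
    moreover have "S \<subseteq># D"
    proof (rule mset_subset_eqI)
      fix y
      show "count S y \<le> count D y"
      proof (cases "y \<in># S")
        case True
        then obtain u where u: "y = Some u" "u \<in> set (v # ws)"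
          unfolding S_def by auto
        have d: "distinct (map Some (v # ws))"
          using ws(2) by (auto simp: distinct_map)
        have "count (mset (map Some (v # ws))) y = 1"
          using d u by (subst distinct_count_atmost_1[THEN iffD1, rule_format]) auto
        then have "count S y = (if u = v then 2 else 1)"
          unfolding S_def u(1) by (auto split: if_splits)
        moreover have "u < k" "u \<noteq> s"
          using u(2) ws v by auto
        ultimately show ?thesis
          using u(1) v(3) occupied[of u] by simp
      qed (simp add: not_in_iff)
    qed
    ultimately show False
      using small by blast
  qed
qed

section \<open>Lower bound: a critical distribution with \<open>k\<close> pebbles\<close>

text \<open>
  With vertex \<open>j\<close> empty, the single pair of pebbles cannot cross \<open>j\<close>: in each reachable
  distribution it lies to the right of \<open>j\<close> or has been used up.
\<close>

definition blocked :: "nat \<Rightarrow> nat option multiset \<Rightarrow> bool" where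
  "blocked j D \<longleftrightarrow> count D (Some 0) = 0 \<and>
     (\<exists>i. (\<forall>v. v \<noteq> i \<longrightarrow> count D v \<le> 1) \<and> count D i \<le> 2 \<and>
       (count D i = 2 \<longrightarrow> count D None = 0 \<and> count D (Some j) = 0 \<and> (\<exists>m>j. i = Some m)))"

text \<open>Only \<open>i\<close> can carry a pair, so the step empties \<open>i\<close>. If it
  lands on the hub or on \<open>j\<close>, both empty before, no pair remains; otherwise it lands to
  the right of \<open>j\<close>, where a new pair is harmless.\<close>

lemma blocked_step:
  assumes "pebbling_step (fan k) D D'" "0 < j" "blocked j D"
  shows "blocked j D'"
  using assms(1)
proof cases
  case (1 a b)
  obtain i where i: "\<And>v. v \<noteq> i \<Longrightarrow> count D v \<le> 1" "count D i \<le> 2"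
    "count D i = 2 \<Longrightarrow> count D None = 0 \<and> count D (Some j) = 0 \<and> (\<exists>m>j. i = Some m)"
    "count D (Some 0) = 0"
    using assms(3) unfolding blocked_def by blast
  have "a = i" using 1(3) i(1)[of a] by fastforce
  then have "count D i = 2" using 1(3) i(2) by simp
  with i(3) obtain m where m: "count D None = 0" "count D (Some j) = 0" "m > j" "i = Some m"
    by blast
  have ab: "a \<noteq> b"
    using 1(2) by (cases a; cases b) (auto simp: parcs_fan)
  have cnt: "count D' v = (if v = b then Suc (count D v) else if v = i then 0 else count D v)" for v
    using 1(1) \<open>a = i\<close> \<open>count D i = 2\<close> ab by auto
  \<comment> \<open>The neighbours of \<open>m > j\<close> are the hub and path vertices at distance
    one from \<open>m\<close>, hence not to the left of \<open>j\<close>.\<close>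
  have b: "b = None \<or> (\<exists>n\<ge>j. b = Some n)"
    using 1(2) m \<open>a = i\<close> by (cases b) (auto simp: parcs_fan)
  then have b0: "b \<noteq> Some 0" using assms(2) by auto
  show ?thesis
    unfolding blocked_def
  \<comment> \<open>After the step only the target \<open>b\<close> can hold two pebbles.\<close>
  proof (intro conjI exI[of _ b] allI impI)
    show "count D' (Some 0) = 0" using b0 i(4) cnt by simp
    show "count D' v \<le> 1" if "v \<noteq> b" for v using that i(1)[of v] cnt by simp
    show "count D' b \<le> 2" using ab \<open>a = i\<close> i(1)[of b] cnt by simp
    assume 2: "count D' b = 2"
    then have "count D b = 1" using cnt by simp
    then have "b \<noteq> None" "b \<noteq> Some j" using m(1,2) by (metis zero_neq_one)+
    with b obtain n where n: "b = Some n" "n > j"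
      by (auto simp: le_less)
    then show "count D' None = 0" "count D' (Some j) = 0" "\<exists>m>j. b = Some m"
      using m cnt by auto
  qed
qed

lemma blocked_unsolvable:
  assumes "0 < j" "blocked j D"
  shows "\<not> solvable (fan k) (Some 0) D"
proof
  assume "solvable (fan k) (Some 0) D"
  then obtain D' where D': "(pebbling_step (fan k))\<^sup>*\<^sup>* D D'" "1 \<le> count D' (Some 0)"
    unfolding solvable_def by blast
  from D'(1) have "blocked j D'"
    by induction (use assms blocked_step in blast)+
  then have "count D' (Some 0) = 0"
    unfolding blocked_def by blast
  with D'(2) show False by linarith
qed

lemma critical_fan_path_transport:
  assumes "k \<ge> 2"
  shows "critical (fan k) (Some 0) (add_mset (Some (k - 1)) (mset_set (Some ` {1..<k})))"
    (is "critical _ _ ?D")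
proof -
  have cnt: "count ?D v = (if v = Some (k - 1) then 2 else if v \<in> Some ` {1..<k} then 1 else 0)" for v
    using assms by auto
  have walk: "Some (k - 1) # map Some (rev [1..<k - 1]) @ [Some 0] = rev (map Some [0..<k])"
    using assms by (cases k) (auto simp: upt_conv_Cons rev_map)
  have "Some (k - 1) # map Some (rev [1..<k - 1]) = map Some (rev [1..<k])"
    using assms by (cases k) auto
  then have "mset (Some (k - 1) # map Some (rev [1..<k - 1])) = mset (map Some (rev [1..<k]))"
    by (rule arg_cong)
  also have "\<dots> = mset_set (Some ` {1..<k})"
    by (simp add: image_mset_mset_set)
  finally have ws: "mset (Some (k - 1) # map Some (rev [1..<k - 1])) = mset_set (Some ` {1..<k})" .
  have "successively (\<lambda>a b. (a, b) \<in> parcs (fan k)) (rev (map Some [0..<k]))"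
    unfolding successively_rev by (auto simp: successively_conv_nth parcs_fan)
  then have "solvable (fan k) (Some 0) ?D"
    using solvable_walk[of "fan k" "Some (k - 1)" "map Some (rev [1..<k - 1])" "Some 0"]
    unfolding walk ws by blast
  moreover have "\<not> solvable (fan k) (Some 0) (?D - {#v#})" if "v \<in># ?D" for v
  proof -
    have "v \<in> Some ` {1..<k}"
      using that assms by auto
    then obtain j where j: "v = Some j" "1 \<le> j" "j < k"
      by auto
    have "count (?D - {#v#}) w = count ?D w - (if w = Some j then 1 else 0)" for w
      using j(1) by simp
    then have "count (?D - {#v#}) w = (if w = Some (k - 1) then 2 else if w \<in> Some ` {1..<k} then 1 else 0)
        - (if w = Some j then 1 else 0)" for w
      unfolding cnt .
    \<comment> \<open>For \<open>j < k - 1\<close> the pair lies to the right of the emptied vertex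
      \<open>j\<close>; for \<open>j = k - 1\<close> no pair is left and the last condition of
      \<open>blocked\<close> is vacuous.\<close>
    then have "blocked j (?D - {#v#})"
      unfolding blocked_def
      by (simp only:) (intro conjI exI[of _ "Some (k - 1)"]; use j in \<open>auto split: if_splits\<close>)
    then show ?thesis
      using j(2) by (intro blocked_unsolvable[of j]) simp_all
  qed
  ultimately show ?thesis
    unfolding critical_def by blast
qed

theorem theorem8:
  fixes k :: nat
  assumes "k \<ge> 4"
  shows "critical_pebbling_number (fan k) = k"
  unfolding critical_pebbling_number_def
proof (rule Greatest_equality)
  let ?D = "add_mset (Some (k - 1)) (mset_set (Some ` {1..<k}))"
  \<comment> \<open>The size is \<open>k - 1\<close> for the vertices other than the root, plus the
    second pebble at the far end.\<close>
  have "Some 0 \<in> pverts (fan k)" "pebbling_distribution (fan k) ?D" "size ?D = k"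
    using assms by (auto simp: pverts_fan pebbling_distribution_def card_image)
  with critical_fan_path_transport[of k] assms
  show "\<exists>r D. r \<in> pverts (fan k) \<and> pebbling_distribution (fan k) D \<and> critical (fan k) r D
      \<and> size D = k"
    by (intro exI[of _ "Some 0"] exI[of _ ?D]) simp
next
  fix n
  assume "\<exists>r D. r \<in> pverts (fan k) \<and> pebbling_distribution (fan k) D \<and> critical (fan k) r D
      \<and> size D = n"
  then show "n \<le> k"
    using critical_fan_size_le[OF assms] by blast
qed

end
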